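(* For every integer $n>2$, let $\theta_n=\pi/(2n)$ and $\lambda_n=2\cos^2(\theta_n)$. Then $(A_{\lambda_n}B_2^{-1})^{2n}$ is a relator of $G_{\lambda_n,2}$ with $4n$ syllables, and hence $$\sigma(G_{\lambda_n,2})\le 4n=\frac{2\pi}{\theta_n}=\frac{2\pi}{\arccos(\sqrt{\lambda_n/2})}.$$
   Context: For $\lambda,\mu\in\mathbb{C}$ let $A_\lambda=\begin{pmatrix}1&\lambda\\0&1\end{pmatrix}$, $B_\mu=\begin{pmatrix}1&0\\ \mu&1\end{pmatrix}$, and $G_{\lambda,\mu}=\langle A_\lambda,B_\mu\rangle\subseteq\mathrm{SL}_2(\mathbb{C})$, with generating set $S=\{A_\lambda,B_\mu\}$. A relator is a nonempty reduced word in the generators (regarded as formal letters) that equals $1$ in the group. If $w=s_1^{n_1}\cdots s_k^{n_k}$ is the reduced form of a word ($s_j\in S$, $s_j\neq s_{j+1}^{\pm1}$ as letters, $n_j\in\mathbb{Z}\setminus\{0\}$), its syllables are the $s_j^{n_j}$, and $\operatorname{syl}(w)=k$ is their number. $\sigma(G)=\sigma_S(G)$ is the minimum of $\operatorname{syl}(w)$ over all relators $w$, and $\sigma(G)=\infty$ if $S$ freely generates $G$. *)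

theory Defs
  imports "HOL-Analysis.Analysis" "HOL-Algebra.Generated_Groups" "HOL-Library.Extended_Nat"
begin

section \<open>Words in formal generators\<close>

text \<open>A letter \<open>(s, True)\<close> stands for the formal generator \<open>s\<close> and \<open>(s, False)\<close> for its formal
  inverse. Formal generators are kept apart from the group elements they denote, so distinct
  letters stay distinct even when they have the same value in the group.\<close>

type_synonym 's gword = "('s \<times> bool) list"

definition reduced_word :: "'s gword \<Rightarrow> bool" where
  "reduced_word w \<longleftrightarrow> successively (\<lambda>x y. \<not> (fst x = fst y \<and> snd x \<noteq> snd y)) w"

definition word_value :: "('a, 'm) monoid_scheme \<Rightarrow> ('s \<Rightarrow> 'a) \<Rightarrow> 's gword \<Rightarrow> 'a" where
  "word_value G g w =
     foldr (\<lambda>(s, e) x. (if e then g s else inv\<^bsub>G\<^esub> (g s)) \<otimes>\<^bsub>G\<^esub> x) w \<one>\<^bsub>G\<^esub>"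

definition word_pow :: "'s gword \<Rightarrow> nat \<Rightarrow> 's gword" where
  "word_pow w k = concat (replicate k w)"

definition relators :: "('a, 'm) monoid_scheme \<Rightarrow> ('s \<Rightarrow> 'a) \<Rightarrow> 's gword set" where
  "relators G g = {w. w \<noteq> [] \<and> reduced_word w \<and> word_value G g w = \<one>\<^bsub>G\<^esub>}"

text \<open>\<open>(s, n)\<close> represents the syllable \<open>s\<^sup>n\<close>. The list \<open>syllables w\<close> is the syllable decomposition of
  the free reduction of \<open>w\<close>; see \<open>syllable_form_syllables\<close> and \<open>word_of_syllables\<close> below.\<close>

fun cons_letter :: "'s \<times> bool \<Rightarrow> ('s \<times> int) list \<Rightarrow> ('s \<times> int) list" where
  "cons_letter (s, e) [] = [(s, if e then 1 else -1)]"
| "cons_letter (s, e) ((t, n) # r) =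
     (let d = (if e then 1 else -1) in
      if s \<noteq> t then (s, d) # (t, n) # r
      else if n + d = 0 then r
      else (t, n + d) # r)"

definition syllables :: "'s gword \<Rightarrow> ('s \<times> int) list" where
  "syllables w = foldr cons_letter w []"

definition syl :: "'s gword \<Rightarrow> nat" where
  "syl w = length (syllables w)"

definition syllable_form :: "('s \<times> int) list \<Rightarrow> bool" where
  "syllable_form ss \<longleftrightarrow>
     successively (\<lambda>x y. fst x \<noteq> fst y) ss \<and> (\<forall>(s, n) \<in> set ss. n \<noteq> 0)"

definition word_of :: "('s \<times> int) list \<Rightarrow> 's gword" where
  "word_of ss = concat (map (\<lambda>(s, n). replicate (nat \<bar>n\<bar>) (s, n > 0)) ss)"

lemma syllable_form_cons_letter:
  "syllable_form ss \<Longrightarrow> syllable_form (cons_letter x ss)"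
  by (cases "(x, ss)" rule: cons_letter.cases)
     (auto simp: syllable_form_def Let_def successively_Cons)

lemma syllable_form_syllables: "syllable_form (syllables w)"
proof (induction w)
  case Nil
  show ?case by (simp add: syllables_def syllable_form_def)
next
  case (Cons x w)
  then show ?case by (simp add: syllables_def syllable_form_cons_letter)
qed

lemma word_of_cons_letter:
  assumes "syllable_form ss" "reduced_word (x # word_of ss)"
  shows "word_of (cons_letter x ss) = x # word_of ss"
proof (cases "(x, ss)" rule: cons_letter.cases)
  case (1 s e)
  then show ?thesis by (auto simp: word_of_def)
next
  case (2 s e t n r)
  then have "n \<noteq> 0" using assms(1) by (auto simp: syllable_form_def)
  show ?thesis
  proof (cases "s = t")
    case False
    then show ?thesis using 2 by (auto simp: word_of_def)
  next
    case True
    obtain k where k: "nat \<bar>n\<bar> = Suc k" using \<open>n \<noteq> 0\<close> by (cases "nat \<bar>n\<bar>") auto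
    then have e: "e \<longleftrightarrow> n > 0"
      using assms(2) 2 True by (auto simp: word_of_def reduced_word_def successively_Cons)
    have m: "nat \<bar>n + (if e then 1 else -1)\<bar> = Suc (nat \<bar>n\<bar>)" using e \<open>n \<noteq> 0\<close> by auto
    have p: "n + (if e then 1 else -1) > 0 \<longleftrightarrow> n > 0" "n + (if e then 1 else -1) \<noteq> 0"
      using e \<open>n \<noteq> 0\<close> by auto
    have "cons_letter x ss = (t, n + (if e then 1 else -1)) # r"
      using 2 True p(2) by (simp only: prod.inject Let_def cons_letter.simps) simp
    then have "word_of (cons_letter x ss) = replicate (Suc (nat \<bar>n\<bar>)) (t, n > 0) @ word_of r"
      unfolding word_of_def using m p(1) by (simp only: list.map concat.simps prod.case)
    then show ?thesis using 2 True e by (simp add: word_of_def)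
  qed
qed

lemma word_of_syllables: "reduced_word w \<Longrightarrow> word_of (syllables w) = w"
proof (induction w)
  case Nil
  show ?case by (simp add: syllables_def word_of_def)
next
  case (Cons x w)
  then have "word_of (syllables w) = w"
    by (auto simp: reduced_word_def successively_Cons)
  then show ?case
    using word_of_cons_letter[OF syllable_form_syllables, of x w] Cons.prems
    by (simp add: syllables_def)
qed

text \<open>The infimum of a nonempty set of extended naturals is attained; it is \<open>\<infinity>\<close> for the empty set,
  i.e. when there are no relators.\<close>

definition syl_sigma :: "('a, 'm) monoid_scheme \<Rightarrow> ('s \<Rightarrow> 'a) \<Rightarrow> enat" where
  "syl_sigma G g = (INF w \<in> relators G g. enat (syl w))"


section \<open>Two-parabolic-generator subgroups of the special linear group\<close>

definition SL2C :: "(complex^2^2) monoid" where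
  "SL2C = \<lparr>carrier = {M. det M = 1}, mult = (\<lambda>M N. M ** N), one = mat 1\<rparr>"

definition matA :: "complex \<Rightarrow> complex^2^2" where
  "matA l = vector [vector [1, l], vector [0, 1]]"

definition matB :: "complex \<Rightarrow> complex^2^2" where
  "matB m = vector [vector [1, 0], vector [m, 1]]"

datatype letter = LA | LB

fun gens :: "complex \<Rightarrow> complex \<Rightarrow> letter \<Rightarrow> complex^2^2" where
  "gens l m LA = matA l"
| "gens l m LB = matB m"

definition Ggrp :: "complex \<Rightarrow> complex \<Rightarrow> (complex^2^2) monoid" where
  "Ggrp l m = SL2C\<lparr>carrier := generate SL2C (range (gens l m))\<rparr>"

lemma group_SL2C: "group SL2C"
proof (rule groupI)
  fix M assume "M \<in> carrier SL2C"
  then have d: "det M = 1" by (simp add: SL2C_def)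
  then have "invertible M" by (simp add: invertible_det_nz)
  then obtain N where N: "N ** M = mat 1" by (auto simp: invertible_def)
  then have "det N * det M = 1" by (metis det_mul det_I)
  then show "\<exists>N\<in>carrier SL2C. N \<otimes>\<^bsub>SL2C\<^esub> M = \<one>\<^bsub>SL2C\<^esub>"
    using N d by (auto simp: SL2C_def)
qed (auto simp: SL2C_def det_mul matrix_mul_assoc)

lemma gens_in_SL2C: "gens l m s \<in> carrier SL2C"
  by (cases s) (simp_all add: SL2C_def matA_def matB_def det_2)

lemma group_Ggrp: "group (Ggrp l m)"
  unfolding Ggrp_def
  by (intro group.subgroup_imp_group group.generate_is_subgroup group_SL2C)
     (auto simp: gens_in_SL2C)

end

theory Submission
  imports Defs
begin

text \<open>
  The matrix \<open>M = A\<^sub>\<lambda> B\<^sub>2\<^sup>-\<^sup>1\<close> has determinant \<open>1\<close> and trace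
  \<open>2 - 2\<lambda> = 2 - 4 cos\<^sup>2 \<theta> = -2 cos (2\<theta>)\<close>, that is \<open>2 cos \<phi>\<close> with \<open>\<phi> = \<pi> - 2\<theta>\<close>. Its
  eigenvalues are therefore \<open>e\<^bsup>\<plusminus>i\<phi>\<^esup>\<close>: it is conjugate to a rotation by \<open>\<phi>\<close>, and since
  \<open>2n\<phi> = 2\<pi>(n - 1)\<close>, its power \<open>M\<^bsup>2n\<^esup>\<close> is the identity. Instead of diagonalising, the proof
  runs through the Chebyshev-type formula of \<open>matpow_rotation\<close>, where the nonvanishing of
  \<open>sin \<phi>\<close> stands in for the eigenvalues being distinct. The formula needs only the
  Cayley-Hamilton relation \<open>M\<^sup>2 = (2 cos \<phi>) M - 1\<close>.

  The letters of \<open>(A B\<^sup>-\<^sup>1)\<^sup>k\<close> alternate between the two generators, so the word is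
  reduced and each of its \<open>2k\<close> letters is a syllable of its own. With \<open>k = 2n\<close> this exhibits a
  relator with \<open>4n\<close> syllables, which bounds the infimum \<open>\<sigma>\<close>.
\<close>

lemma word_pow_Suc: "word_pow w (Suc k) = w @ word_pow w k"
  by (simp add: word_pow_def)

lemma reduced_word_pow_alternating:
  assumes "s \<noteq> t"
  shows "reduced_word (word_pow [(s, d), (t, e)] k)"
proof (induction k)
  case 0
  show ?case by (simp add: word_pow_def reduced_word_def)
next
  case (Suc k)
  then show ?case
    using assms by (cases k) (auto simp: word_pow_def reduced_word_def successively_Cons)
qed

lemma syllables_word_pow_alternating:
  assumes "s \<noteq> t"
  shows "syllables (word_pow [(s, d), (t, e)] k) =
    concat (replicate k [(s, if d then 1 else -1), (t, if e then 1 else -1)])"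
proof (induction k)
  case 0
  show ?case by (simp add: word_pow_def syllables_def)
next
  case (Suc k)
  then show ?case
    using assms by (cases k) (auto simp: word_pow_Suc syllables_def)
qed

lemma syl_word_pow_alternating:
  assumes "s \<noteq> t"
  shows "syl (word_pow [(s, d), (t, e)] k) = 2 * k"
  using syllables_word_pow_alternating[OF assms, of d e k]
  by (simp add: syl_def length_concat sum_list_replicate)

lemma syl_sigma_le:
  assumes "w \<in> relators G g"
  shows "syl_sigma G g \<le> enat (syl w)"
  unfolding syl_sigma_def using assms by (rule INF_lower)

lemma inv_matB: "inv\<^bsub>Ggrp l m\<^esub> (matB m) = matB (- m)"
proof -
  interpret S: group SL2C by (rule group_SL2C)
  have sub: "subgroup (generate SL2C (range (gens l m))) SL2C"
    by (rule S.generate_is_subgroup) (auto simp: gens_in_SL2C)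
  have mem: "matB m \<in> generate SL2C (range (gens l m))"
    by (rule generate.incl) (metis gens.simps(2) rangeI)
  have "inv\<^bsub>SL2C\<^esub> (matB m) = matB (- m)"
  proof (rule S.inv_equality)
    show "matB (- m) \<otimes>\<^bsub>SL2C\<^esub> matB m = \<one>\<^bsub>SL2C\<^esub>"
      by (simp add: SL2C_def matB_def matrix_matrix_mult_def vec_eq_iff forall_2 sum_2 mat_def)
    show "matB m \<in> carrier SL2C" "matB (- m) \<in> carrier SL2C"
      by (simp_all add: SL2C_def matB_def det_2)
  qed
  then show ?thesis
    using S.m_inv_consistent[OF sub mem] by (simp add: Ggrp_def)
qed

lemma word_value_word_pow:
  "word_value (Ggrp l m) (gens l m) (word_pow [(LA, True), (LB, False)] k) =
    (((**) (matA l ** matB (- m))) ^^ k) (mat 1)"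
proof (induction k)
  case 0
  show ?case by (simp add: word_pow_def word_value_def Ggrp_def SL2C_def)
next
  case (Suc k)
  have "x \<otimes>\<^bsub>Ggrp l m\<^esub> y = x ** y" for x y
    by (simp add: Ggrp_def SL2C_def)
  with Suc show ?case
    by (simp add: word_pow_Suc word_value_def inv_matB matrix_mul_assoc)
qed

text \<open>
  Both sides satisfy the recurrence \<open>X\<^sub>k\<^sub>+\<^sub>1 = M X\<^sub>k\<close>: on the right, the Cayley-Hamilton
  relation turns it into \<open>sin ((k + 1)\<phi>) + sin ((k - 1)\<phi>) = 2 cos \<phi> sin (k\<phi>)\<close>. Multiplying
  by \<open>sin \<phi>\<close> avoids dividing by it.
\<close>

lemma matpow_rotation:
  fixes M :: "'a::real_algebra_1^'n^'n"
  assumes "M ** M = (2 * cos \<phi>) *\<^sub>R M - mat 1"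
  shows "sin \<phi> *\<^sub>R (((**) M) ^^ k) (mat 1) =
    sin (real k * \<phi>) *\<^sub>R M - sin ((real k - 1) * \<phi>) *\<^sub>R mat 1"
proof (induction k)
  case 0
  show ?case by simp
next
  case (Suc k)
  have scale: "M ** (c *\<^sub>R X) = c *\<^sub>R (M ** X)" for c and X :: "'a^'n^'n"
    by (simp add: matrix_matrix_mult_def vec_eq_iff scaleR_sum_right)
  have diff: "M ** (X - Y) = M ** X - M ** Y" for X Y :: "'a^'n^'n"
    by (simp add: matrix_matrix_mult_def vec_eq_iff sum_subtractf right_diff_distrib)
  have trig: "sin (real (Suc k) * \<phi>) =
      sin (real k * \<phi>) * (2 * cos \<phi>) - sin ((real k - 1) * \<phi>)"
    by (simp add: algebra_simps sin_add sin_diff)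
  have "sin \<phi> *\<^sub>R (((**) M) ^^ Suc k) (mat 1) = M ** (sin \<phi> *\<^sub>R (((**) M) ^^ k) (mat 1))"
    by (simp add: scale)
  also have "\<dots> = sin (real k * \<phi>) *\<^sub>R (M ** M) - sin ((real k - 1) * \<phi>) *\<^sub>R M"
    by (simp add: Suc.IH diff scale)
  also have "\<dots> = sin (real (Suc k) * \<phi>) *\<^sub>R M - sin (real k * \<phi>) *\<^sub>R mat 1"
    unfolding assms trig by (simp add: algebra_simps)
  finally show ?case by simp
qed

text \<open>The trace of \<open>A\<^sub>\<lambda> B\<^sub>2\<^sup>-\<^sup>1\<close> is \<open>2 - 2\<lambda>\<close>; this is its Cayley-Hamilton relation.\<close>

lemma matAB_square:
  fixes lam :: real
  defines "M \<equiv> matA (complex_of_real lam) ** matB (- 2)"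
  shows "M ** M = (2 - 2 * lam) *\<^sub>R M - mat 1"
  unfolding M_def
  by (simp add: matA_def matB_def matrix_matrix_mult_def vec_eq_iff forall_2 sum_2 mat_def)
     (simp add: complex_eq_iff algebra_simps)

lemma matAB_pow_eq_one:
  fixes n :: nat
  assumes "n > 1"
  shows "(((**) (matA (complex_of_real (2 * (cos (pi / (2 * real n)))\<^sup>2)) ** matB (- 2))) ^^ (2 * n))
    (mat 1) = mat 1"
proof -
  define \<theta> where "\<theta> = pi / (2 * real n)"
  define \<phi> where "\<phi> = pi - 2 * \<theta>"
  define M where "M = matA (complex_of_real (2 * (cos \<theta>)\<^sup>2)) ** matB (- 2)"
  have "2 - 2 * (2 * (cos \<theta>)\<^sup>2) = 2 * cos \<phi>"
    by (simp add: \<phi>_def cos_diff cos_double_cos)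
  then have square: "M ** M = (2 * cos \<phi>) *\<^sub>R M - mat 1"
    using matAB_square[of "2 * (cos \<theta>)\<^sup>2"] by (simp add: M_def)
  have "0 < 2 * \<theta>" "2 * \<theta> < pi"
    using assms by (simp_all add: \<theta>_def field_simps)
  then have sin_nz: "sin \<phi> \<noteq> 0"
    using sin_gt_zero[of "2 * \<theta>"] by (simp add: \<phi>_def)
  have angle: "real (2 * n) * \<phi> = 2 * real (n - 1) * pi"
    using assms by (simp add: \<phi>_def \<theta>_def field_simps)
  have "sin (real (2 * n) * \<phi>) = 0" "cos (real (2 * n) * \<phi>) = 1"
    by (simp_all only: angle sin_2npi cos_2npi)
  moreover from this have "sin ((real (2 * n) - 1) * \<phi>) = - sin \<phi>"
    by (simp add: left_diff_distrib sin_diff)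
  ultimately have "sin \<phi> *\<^sub>R (((**) M) ^^ (2 * n)) (mat 1) = sin \<phi> *\<^sub>R mat 1"
    using matpow_rotation[OF square, of "2 * n"] by simp
  then show ?thesis
    using sin_nz by (simp add: M_def \<theta>_def)
qed

theorem mainTheorem6:
  fixes n :: nat and \<theta> lam :: real
  assumes "n > 2"
    and "\<theta> = pi / (2 * real n)"
    and "lam = 2 * (cos \<theta>)\<^sup>2"
  shows "word_pow [(LA, True), (LB, False)] (2 * n)
           \<in> relators (Ggrp (complex_of_real lam) 2) (gens (complex_of_real lam) 2)
       \<and> syl (word_pow [(LA, True), (LB, False)] (2 * n)) = 4 * n
       \<and> syl_sigma (Ggrp (complex_of_real lam) 2) (gens (complex_of_real lam) 2) \<le> enat (4 * n)
       \<and> real (4 * n) = 2 * pi / \<theta>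
       \<and> 2 * pi / \<theta> = 2 * pi / arccos (sqrt (lam / 2))"
proof -
  let ?w = "word_pow [(LA, True), (LB, False)] (2 * n)"
  let ?G = "Ggrp (complex_of_real lam) 2" and ?g = "gens (complex_of_real lam) 2"
  have syl: "syl ?w = 4 * n"
    by (simp add: syl_word_pow_alternating)
  have "word_value ?G ?g ?w = \<one>\<^bsub>?G\<^esub>"
    using matAB_pow_eq_one[of n] assms
    by (simp add: word_value_word_pow) (simp add: Ggrp_def SL2C_def)
  moreover have "?w \<noteq> []"
    using syl assms(1) by (auto simp: syl_def syllables_def)
  ultimately have rel: "?w \<in> relators ?G ?g"
    by (simp add: relators_def reduced_word_pow_alternating)
  have range: "0 \<le> \<theta>" "\<theta> \<le> pi / 2"
    using assms(1) by (simp_all add: assms(2) field_simps)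
  then have "sqrt (lam / 2) = cos \<theta>"
    by (simp add: assms(3) cos_ge_zero)
  then have "arccos (sqrt (lam / 2)) = \<theta>"
    using range by (simp add: arccos_cos)
  moreover have "real (4 * n) = 2 * pi / \<theta>"
    using assms(1) by (simp add: assms(2))
  ultimately show ?thesis
    using rel syl syl_sigma_le[OF rel] by simp
qed

end
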